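(* Let $n\ge 2$ and let $q_1,q_2,\dots,q_n$ be rational numbers. Then there exists a rational function $f(x)$ with rational coefficients such that: (1) for every $i$, $f(q_i)$ is either $0$ or $\infty$; (2) $f(\infty)=1$; (3) the map $f:\mathbb{P}^1\to\mathbb{P}^1$ is unramified at every point of $\mathbb{P}^1$ other than the points $q_1,\dots,q_n$ and $\infty$.
   Context: A rational function $f\in\mathbb{Q}(x)$ is regarded as a morphism $\mathbb{P}^1\to\mathbb{P}^1$ (over $\mathbb{C}$, say); it is unramified at a point $P$ if its local ramification index at $P$ equals $1$. *)

theory Defs
  imports Complex_Main "HOL-Computational_Algebra.Computational_Algebra" "HOL-Computational_Algebra.Field_as_Ring"
begin

datatype 'a P1 = Fin 'a | Infty

definition ratfun_num :: "'a::field_gcd poly fract \<Rightarrow> 'a poly" where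
  "ratfun_num f = fst (quot_of_fract f)"

definition ratfun_denom :: "'a::field_gcd poly fract \<Rightarrow> 'a poly" where
  "ratfun_denom f = snd (quot_of_fract f)"

(* Numerator and denominator are coprime, so no point is a common zero; at infinity the value
   is read off from the leading terms. *)
fun P1_map :: "'a::field_gcd poly fract \<Rightarrow> 'a P1 \<Rightarrow> 'a P1" where
  "P1_map f (Fin a) =
     (if poly (ratfun_denom f) a = 0 then Infty
      else Fin (poly (ratfun_num f) a / poly (ratfun_denom f) a))"
| "P1_map f Infty =
     (if degree (ratfun_num f) > degree (ratfun_denom f) then Infty
      else Fin (coeff (ratfun_num f) (degree (ratfun_denom f)) / lead_coeff (ratfun_denom f)))"

(* Order of vanishing of a nonzero rational function at a point; the value at f = 0 is a dummy. *)
fun ord_at :: "'a::field_gcd P1 \<Rightarrow> 'a poly fract \<Rightarrow> int" where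
  "ord_at (Fin a) f =
     (if f = 0 then 0 else int (order a (ratfun_num f)) - int (order a (ratfun_denom f)))"
| "ord_at Infty f =
     (if f = 0 then 0 else int (degree (ratfun_denom f)) - int (degree (ratfun_num f)))"

(* Order at P of the pullback along f of a local parameter at Q = f(P): the parameter is
   y - c at a finite point c and 1/y at infinity.  A constant f gets index 0, so it is nowhere
   unramified. *)
definition ramification_index :: "'a::field_gcd poly fract \<Rightarrow> 'a P1 \<Rightarrow> int" where
  "ramification_index f P =
     (case P1_map f P of
        Fin c \<Rightarrow> ord_at P (f - to_fract [:c:])
      | Infty \<Rightarrow> ord_at P (inverse f))"

definition unramified_at :: "'a::field_gcd poly fract \<Rightarrow> 'a P1 \<Rightarrow> bool" where
  "unramified_at f P \<longleftrightarrow> ramification_index f P = 1"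

definition complexify :: "rat poly fract \<Rightarrow> complex poly fract" where
  "complexify f =
     Fract (map_poly of_rat (ratfun_num f)) (map_poly of_rat (ratfun_denom f))"

end

theory Submission
  imports Defs
begin

text \<open>
  For a finite set \<open>S\<close> of at least two rationals, Lagrange interpolation of the constant \<open>1\<close> gives
  \<open>\<Sum>q\<in>S. w q / (x - q) = 1 / (\<Prod>q\<in>S. x - q)\<close> with \<open>w q = 1 / (\<Prod>j\<in>S - {q}. q - j)\<close>, and comparing
  coefficients of degree \<open>card S - 1\<close> gives \<open>\<Sum>q\<in>S. w q = 0\<close>. After clearing denominators the
  weights become integers \<open>a q = N * w q\<close>, and \<open>f = (\<Prod>q\<in>S. (x - q) powi a q)\<close> satisfies
  \<open>f(\<infinity>) = 1\<close> and \<open>f' / f = N / (\<Prod>q\<in>S. x - q)\<close>, which vanishes at no finite point.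
  If all the given points coincide, \<open>f = 1 + 1 / (x - q)\<close> is an automorphism of the line.
\<close>

section \<open>Base change of polynomials and products of linear factors\<close>

lemma map_poly_of_rat_mult:
  "map_poly (of_rat :: rat \<Rightarrow> 'a::field_char_0) (p * q) = map_poly of_rat p * map_poly of_rat q"
  by (rule poly_eqI) (simp add: coeff_map_poly coeff_mult of_rat_sum of_rat_mult)

lemma map_poly_of_rat_power:
  "map_poly (of_rat :: rat \<Rightarrow> 'a::field_char_0) (p ^ n) = map_poly of_rat p ^ n"
  by (induction n) (simp_all add: map_poly_of_rat_mult)

lemma map_poly_of_rat_prod:
  "map_poly (of_rat :: rat \<Rightarrow> 'a::field_char_0) (\<Prod>i\<in>I. p i) = (\<Prod>i\<in>I. map_poly of_rat (p i))"
  by (induction I rule: infinite_finite_induct) (simp_all add: map_poly_of_rat_mult)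

text \<open>The points come from a map \<open>x\<close> on an index set, so that passing from the
  rationals to an extension field changes only \<open>x\<close> and keeps \<open>k\<close> and
  \<open>I\<close>.\<close>

definition linear_prod :: "('i \<Rightarrow> 'a) \<Rightarrow> ('i \<Rightarrow> nat) \<Rightarrow> 'i set \<Rightarrow> 'a::field poly" where
  "linear_prod x k I = (\<Prod>i\<in>I. [:- x i, 1:] ^ k i)"

lemma linear_prod_nonzero [simp]: "linear_prod x k I \<noteq> 0"
  by (cases "finite I") (simp_all add: linear_prod_def)

lemma lead_coeff_linear_prod [simp]: "lead_coeff (linear_prod x k I) = 1"
  by (simp add: linear_prod_def lead_coeff_prod lead_coeff_power)

lemma degree_linear_prod: "degree (linear_prod x k I) = sum k I"
  by (simp add: linear_prod_def degree_prod_sum_eq degree_linear_power)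

lemma poly_linear_prod: "poly (linear_prod x k I) z = (\<Prod>i\<in>I. (z - x i) ^ k i)"
  by (simp add: linear_prod_def poly_prod)

lemma map_poly_of_rat_linear_prod:
  "map_poly (of_rat :: rat \<Rightarrow> 'a::field_char_0) (linear_prod x k I) =
     linear_prod (\<lambda>i. of_rat (x i)) k I"
  by (simp add: linear_prod_def map_poly_of_rat_prod map_poly_of_rat_power map_poly_pCons
      of_rat_minus)

text \<open>A common divisor of two linear factors divides their difference, here a nonzero
  constant; coprimality then passes to powers and products.\<close>

lemma coprime_linear_prod:
  fixes x :: "'i \<Rightarrow> 'a::field_gcd"
  assumes "\<And>i j. i \<in> I \<Longrightarrow> j \<in> J \<Longrightarrow> x i \<noteq> x j"
  shows "coprime (linear_prod x k I) (linear_prod x k J)"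
proof -
  have "coprime [:- x i, 1:] [:- x j, 1:]" if "i \<in> I" "j \<in> J" for i j
  proof (rule coprimeI)
    fix d assume "d dvd [:- x i, 1:]" "d dvd [:- x j, 1:]"
    then have "d dvd [:- x i, 1:] - [:- x j, 1:]"
      by (rule dvd_diff)
    then have "d dvd [:x j - x i:]"
      by simp
    moreover have "is_unit [:x j - x i:]"
      using assms[OF that] by (simp add: is_unit_const_poly_iff dvd_field_iff)
    ultimately show "is_unit d"
      by (rule dvd_trans)
  qed
  then show ?thesis
    unfolding linear_prod_def
    by (intro prod_coprime_left prod_coprime_right) simp
qed

text \<open>This is the logarithmic derivative of the product, multiplied by its value at
  \<open>z\<close>; the product rule adds one summand per factor.\<close>

lemma poly_pderiv_linear_prod:
  fixes x :: "'i \<Rightarrow> 'a::field"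
  assumes "finite I" "\<And>i. i \<in> I \<Longrightarrow> z \<noteq> x i"
  shows "poly (pderiv (linear_prod x k I)) z =
    poly (linear_prod x k I) z * (\<Sum>i\<in>I. of_nat (k i) / (z - x i))"
  using assms
proof (induction I rule: finite_induct)
  case empty
  then show ?case
    by (simp add: linear_prod_def)
next
  case (insert i I)
  have "linear_prod x k (insert i I) = [:- x i, 1:] ^ k i * linear_prod x k I"
    using insert.hyps by (simp add: linear_prod_def)
  moreover have "poly (pderiv ([:- x i, 1:] ^ k i)) z = (z - x i) ^ k i * (of_nat (k i) / (z - x i))"
    using insert.prems[of i]
    by (cases "k i")
      (simp_all add: pderiv_power_Suc pderiv_pCons field_simps del: of_nat_Suc power_Suc,
        simp add: field_simps)
  ultimately show ?case
    using insert by (simp add: pderiv_mult algebra_simps)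
qed

section \<open>Lagrange interpolation of the constant 1\<close>

lemma sum_lagrange_basis:
  fixes x :: "'i \<Rightarrow> 'a::field"
  assumes "finite I" "I \<noteq> {}" "inj_on x I"
  shows "(\<Sum>i\<in>I. smult (1 / (\<Prod>j\<in>I - {i}. x i - x j)) (linear_prod x (\<lambda>_. 1) (I - {i}))) = 1"
    (is "?p = 1")
\<comment> \<open>Both sides have degree below \<open>card I\<close>, so it suffices that they agree
  at the \<open>card I\<close> distinct points \<open>x i\<close>.\<close>
proof (rule poly_eqI_degree[where A = "x ` I"])
  have "degree ?p \<le> card I - 1"
    using assms(1)
    by (intro degree_sum_le) (auto intro: order.trans[OF degree_smult_le] simp: degree_linear_prod)
  moreover have "card (x ` I) = card I" "card I > 0"
    using assms by (auto simp: card_image card_gt_0_iff)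
  ultimately show "card (x ` I) > degree ?p" "card (x ` I) > degree (1 :: 'a poly)"
    by simp_all
next
  fix y assume "y \<in> x ` I"
  then obtain m where m: "m \<in> I" "y = x m"
    by blast
  have "poly ?p y = (\<Sum>i\<in>I. if i = m then 1 else 0)"
    unfolding poly_sum
  proof (rule sum.cong[OF refl])
    fix i assume i: "i \<in> I"
    show "poly (smult (1 / (\<Prod>j\<in>I - {i}. x i - x j)) (linear_prod x (\<lambda>_. 1) (I - {i}))) y =
        (if i = m then 1 else 0)"
    proof (cases "i = m")
      case True
      have "(\<Prod>j\<in>I - {m}. x m - x j) \<noteq> 0"
        using assms m by (auto simp: inj_on_def)
      then show ?thesis
        using True m by (simp add: poly_linear_prod)
    next
      case False
      then have "(\<Prod>j\<in>I - {i}. x m - x j) = 0"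
        using assms m by (auto simp: prod_zero_iff)
      then show ?thesis
        using False m by (simp add: poly_linear_prod)
    qed
  qed
  then show "poly ?p y = poly 1 y"
    using assms m by simp
qed

text \<open>Each basis product is monic of degree \<open>card I - 1\<close>, so the weights add up
  to the coefficient of 1 in that degree. It is 0 because the degree is positive.\<close>

lemma sum_lagrange_weights_eq_0:
  fixes x :: "'i \<Rightarrow> 'a::field"
  assumes "finite I" "card I \<ge> 2" "inj_on x I"
  shows "(\<Sum>i\<in>I. 1 / (\<Prod>j\<in>I - {i}. x i - x j)) = 0"
proof -
  have top: "coeff (linear_prod x (\<lambda>_. 1) (I - {i})) (card I - 1) = 1" if "i \<in> I" for i
    using lead_coeff_linear_prod[of x "\<lambda>_. 1" "I - {i}"] that assms(1)
    unfolding degree_linear_prod by simp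
  have "I \<noteq> {}"
    using assms by auto
  have "coeff (\<Sum>i\<in>I. smult (1 / (\<Prod>j\<in>I - {i}. x i - x j))
      (linear_prod x (\<lambda>_. 1) (I - {i}))) (card I - 1) = coeff 1 (card I - 1)"
    using sum_lagrange_basis[OF assms(1) \<open>I \<noteq> {}\<close> assms(3)] by (rule arg_cong)
  then show ?thesis
    using assms(2) by (simp add: coeff_sum top del: One_nat_def)
qed

text \<open>Partial fractions: evaluate the interpolation identity at \<open>z\<close> and divide by
  the full product.\<close>

lemma sum_lagrange_weights_div:
  fixes x :: "'i \<Rightarrow> 'a::field"
  assumes "finite I" "I \<noteq> {}" "inj_on x I" "\<And>i. i \<in> I \<Longrightarrow> z \<noteq> x i"
  shows "(\<Sum>i\<in>I. (1 / (\<Prod>j\<in>I - {i}. x i - x j)) / (z - x i)) = 1 / (\<Prod>i\<in>I. z - x i)"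
proof -
  have nz: "(\<Prod>i\<in>I. z - x i) \<noteq> 0"
    using assms by auto
  have "1 = poly 1 z"
    by simp
  also have "\<dots> = (\<Sum>i\<in>I. (1 / (\<Prod>j\<in>I - {i}. x i - x j)) * (\<Prod>j\<in>I - {i}. z - x j))"
    by (subst sum_lagrange_basis[OF assms(1-3), symmetric]) (simp add: poly_sum poly_linear_prod)
  also have "\<dots> = (\<Sum>i\<in>I. (1 / (\<Prod>j\<in>I - {i}. x i - x j)) / (z - x i)) * (\<Prod>i\<in>I. z - x i)"
    unfolding sum_distrib_right
  proof (rule sum.cong[OF refl])
    fix i assume "i \<in> I"
    then have "(\<Prod>i\<in>I. z - x i) = (z - x i) * (\<Prod>j\<in>I - {i}. z - x j)" "z \<noteq> x i"
      using assms by (auto simp: prod.remove)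
    then show "(1 / (\<Prod>j\<in>I - {i}. x i - x j)) * (\<Prod>j\<in>I - {i}. z - x j) =
        (1 / (\<Prod>j\<in>I - {i}. x i - x j)) / (z - x i) * (\<Prod>i\<in>I. z - x i)"
      by simp
  qed
  finally show ?thesis
    using nz by (simp add: eq_divide_eq)
qed

lemma common_denominator:
  fixes w :: "'i \<Rightarrow> rat"
  assumes "finite I"
  obtains N :: int and a :: "'i \<Rightarrow> int"
  where "N > 0" "\<And>i. i \<in> I \<Longrightarrow> of_int (a i) = of_int N * w i"
proof -
  have "\<exists>N>0. \<forall>i\<in>I. \<exists>b::int. of_int b = of_int N * w i"
    using assms
  proof (induction I rule: finite_induct)
    case empty
    then show ?case
      by (intro exI[of _ 1]) simp
  next
    case (insert i I)
    then obtain N where N: "N > 0" "\<forall>i\<in>I. \<exists>b::int. of_int b = of_int N * w i"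
      by blast
    obtain c d where cd: "w i = Rat.Fract c d" "d > 0"
      by (cases "w i")
    have "\<exists>b::int. of_int b = of_int (N * d) * w j" if "j \<in> insert i I" for j
    proof (cases "j = i")
      case True
      then have "of_int (N * c) = of_int (N * d) * w j"
        using cd by (simp add: Fract_of_int_quotient)
      then show ?thesis ..
    next
      case False
      with that have "j \<in> I"
        by simp
      with N(2) obtain b :: int where "of_int b = of_int N * w j"
        by metis
      then have "of_int (b * d) = of_int (N * d) * w j"
        by simp
      then show ?thesis ..
    qed
    with N cd show ?case
      by (intro exI[of _ "N * d"]) simp
  qed
  then show ?thesis
    using that by metis
qed

section \<open>Reduced fractions and a criterion for being unramified\<close>

lemma
  fixes A B :: "'a::field_gcd poly"
  assumes "coprime A B" "lead_coeff B = 1"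
  shows ratfun_num_Fract: "ratfun_num (Fract A B) = A"
    and ratfun_denom_Fract: "ratfun_denom (Fract A B) = B"
proof -
  \<comment> \<open>The normal form of a fraction asks for coprime entries and a denominator with
    unit factor 1, which over a field means monic.\<close>
  have "(A, B) \<in> normalized_fracts"
    using assms by (simp add: normalized_fracts_def unit_factor_poly_def)
  then have "quot_of_fract (Fract A B) = (A, B)"
    using quot_of_fract_quot_to_fract'[of "(A, B)"] by (simp add: quot_to_fract_def)
  then show "ratfun_num (Fract A B) = A" "ratfun_denom (Fract A B) = B"
    by (simp_all add: ratfun_num_def ratfun_denom_def)
qed

text \<open>Subtracting the value \<open>c\<close> at \<open>z\<close> gives \<open>D / B\<close>
  with \<open>D\<close> vanishing at \<open>z\<close>. At \<open>z\<close> the Wronskian equals the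
  derivative of \<open>D\<close> times \<open>B\<close>, so the zero is simple.\<close>

lemma unramified_at_Fract:
  fixes A B :: "'a::{field_gcd, field_char_0} poly"
  assumes "coprime A B" "lead_coeff B = 1" "poly B z \<noteq> 0"
    and wronskian: "poly (pderiv A * B - A * pderiv B) z \<noteq> 0"
  shows "unramified_at (Fract A B) (Fin z)"
proof -
  define c where "c = poly A z / poly B z"
  define D where "D = A - [:c:] * B"
  have "B \<noteq> 0"
    using assms by auto
  \<comment> \<open>Thus \<open>D / B\<close> is already reduced, and its order at \<open>z\<close>
    can be read off from \<open>D\<close> and \<open>B\<close>.\<close>
  have "coprime D B"
  proof (rule coprimeI)
    fix d assume d: "d dvd D" "d dvd B"
    then have "d dvd D + [:c:] * B"
      by (intro dvd_add dvd_mult)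
    then have "d dvd A"
      by (simp add: D_def)
    then show "is_unit d"
      using d(2) by (rule coprime_common_divisor[OF assms(1)])
  qed
  have "Fract A B - to_fract [:c:] = Fract D B"
    using \<open>B \<noteq> 0\<close> by (simp add: to_fract_def D_def mult.commute)
  moreover have "poly D z = 0"
    using assms(3) by (simp add: D_def c_def)
  have "poly (pderiv D) z * poly B z = poly (pderiv A * B - A * pderiv B) z"
    using assms(3) by (simp add: D_def c_def pderiv_diff pderiv_mult pderiv_smult pderiv_pCons field_simps)
  then have "poly (pderiv D) z \<noteq> 0"
    using wronskian by auto
  then have "D \<noteq> 0" "order z (pderiv D) = 0"
    by (auto intro: order_0I)
  then have "order z D = 1"
    using \<open>poly D z = 0\<close> order_pderiv[of D z] by simp
  moreover have "order z B = 0"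
    using assms(3) by (rule order_0I)
  moreover have "Fract D B \<noteq> 0"
    using \<open>D \<noteq> 0\<close> \<open>B \<noteq> 0\<close> by (simp add: Zero_fract_def eq_fract)
  moreover have "P1_map (Fract A B) (Fin z) = Fin c"
    using assms by (simp add: ratfun_num_Fract ratfun_denom_Fract c_def)
  ultimately show ?thesis
    using \<open>coprime D B\<close> assms(2)
    by (simp add: unramified_at_def ramification_index_def ratfun_num_Fract ratfun_denom_Fract)
qed

section \<open>Construction of the function from its zeros and poles\<close>

lemma linear_prod_ratfun:
  fixes T U S :: "rat set" and k :: "rat \<Rightarrow> nat"
  defines "A \<equiv> linear_prod of_rat k T" and "B \<equiv> linear_prod of_rat k U :: complex poly"
  assumes fin: "finite T" "finite U" and disj: "T \<inter> U = {}" and deg: "sum k T = sum k U"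
    and supp: "U \<subseteq> S" "S \<subseteq> T \<union> U" "\<And>s. s \<in> S \<Longrightarrow> k s > 0"
    and wronskian: "\<And>z. z \<notin> of_rat ` S \<Longrightarrow> poly (pderiv A * B - A * pderiv B) z \<noteq> 0"
  shows "\<exists>f :: rat poly fract.
    (\<forall>s\<in>S. P1_map (complexify f) (Fin (of_rat s)) \<in> {Fin 0, Infty}) \<and>
    P1_map (complexify f) Infty = Fin 1 \<and>
    (\<forall>P. P \<notin> insert Infty ((\<lambda>s. Fin (of_rat s)) ` S) \<longrightarrow> unramified_at (complexify f) P)"
proof -
  \<comment> \<open>The zeros are \<open>T\<close> and the poles \<open>U\<close>, with
    multiplicities \<open>k\<close>. \<open>T\<close> may leave \<open>S\<close>, which the case of
    a single point requires.\<close>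
  define f :: "rat poly fract" where
    "f = Fract (linear_prod (\<lambda>q. q) k T) (linear_prod (\<lambda>q. q) k U)"
  have "coprime (linear_prod (\<lambda>q. q) k T) (linear_prod (\<lambda>q. q) k U)"
    using disj by (intro coprime_linear_prod) auto
  then have f: "complexify f = Fract A B"
    by (simp add: complexify_def f_def A_def B_def ratfun_num_Fract ratfun_denom_Fract
        map_poly_of_rat_linear_prod)
  have cop: "coprime A B"
    unfolding A_def B_def using disj by (intro coprime_linear_prod) auto
  have monic: "lead_coeff A = 1" "lead_coeff B = 1"
    by (simp_all add: A_def B_def)
  have degAB: "degree A = degree B"
    by (simp add: A_def B_def degree_linear_prod deg)
  note fractAB = ratfun_num_Fract[OF cop monic(2)] ratfun_denom_Fract[OF cop monic(2)]
  have "P1_map (Fract A B) (Fin (of_rat s)) \<in> {Fin 0, Infty}" if "s \<in> S" for s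
  proof -
    have "poly A (of_rat s) = 0 \<or> poly B (of_rat s) = 0"
      using that supp fin by (force simp: A_def B_def poly_linear_prod prod_zero_iff)
    then show ?thesis
      by (auto simp: fractAB)
  qed
  \<comment> \<open>Numerator and denominator are monic of equal degree.\<close>
  moreover have "P1_map (Fract A B) Infty = Fin 1"
    using monic degAB by (simp add: fractAB)
  moreover have "unramified_at (Fract A B) P"
    if "P \<notin> insert Infty ((\<lambda>s. Fin (of_rat s)) ` S)" for P
  proof (cases P)
    case (Fin z)
    then have z: "z \<notin> of_rat ` S"
      using that by auto
    \<comment> \<open>All poles lie in \<open>S\<close>, so the value at \<open>z\<close> is finite
      and the Wronskian criterion applies.\<close>
    then have "poly B z \<noteq> 0"
      using supp fin by (auto simp: B_def poly_linear_prod prod_zero_iff)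
    then show ?thesis
      using unramified_at_Fract[OF cop monic(2)] wronskian[OF z] Fin by simp
  qed (use that in simp)
  ultimately show ?thesis
    using f by (intro exI[of _ f]) simp
qed

lemma ratfun_unramified_outside_exists:
  fixes S :: "rat set"
  assumes "finite S" "S \<noteq> {}"
  shows "\<exists>f :: rat poly fract.
    (\<forall>s\<in>S. P1_map (complexify f) (Fin (of_rat s)) \<in> {Fin 0, Infty}) \<and>
    P1_map (complexify f) Infty = Fin 1 \<and>
    (\<forall>P. P \<notin> insert Infty ((\<lambda>s. Fin (of_rat s)) ` S) \<longrightarrow> unramified_at (complexify f) P)"
proof (cases "card S \<ge> 2")
  case False
  moreover have "card S > 0"
    using assms by (simp add: card_gt_0_iff)
  ultimately have "card S = 1"
    by simp
  then obtain q where "S = {q}"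
    by (rule card_1_singletonE)
  then show ?thesis
    \<comment> \<open>The zero of \<open>1 + 1 / (x - q)\<close> is \<open>q - 1\<close>, and the
      Wronskian is the constant -1.\<close>
    by (intro linear_prod_ratfun[of "{q - 1}" "{q}" "\<lambda>_. 1"])
      (simp_all add: linear_prod_def pderiv_pCons of_rat_diff)
next
  case True
  define w :: "rat \<Rightarrow> rat" where "w q = 1 / (\<Prod>j\<in>S - {q}. q - j)" for q
  obtain N a where N: "N > 0" and a: "\<And>q. q \<in> S \<Longrightarrow> of_int (a q) = of_int N * w q"
    using common_denominator[OF assms(1)] by metis
  \<comment> \<open>The sign of the exponent \<open>a q\<close> decides between zero and
    pole.\<close>
  define T where "T = {q \<in> S. a q > 0}"
  define U where "U = {q \<in> S. a q < 0}"
  define k where "k q = nat \<bar>a q\<bar>" for q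
  \<comment> \<open>No point of \<open>S\<close> may drop out of the product, since each must be a
    zero or a pole.\<close>
  have a_nonzero: "a q \<noteq> 0" if "q \<in> S" for q
  proof -
    have "w q \<noteq> 0"
      using assms by (simp add: w_def)
    then show ?thesis
      using a[OF that] N by auto
  qed
  have "S = T \<union> U"
    using a_nonzero by (force simp: T_def U_def)
  then have TU: "finite T" "finite U" "T \<inter> U = {}" "S = T \<union> U"
    using assms(1) by (auto simp: T_def U_def)
  \<comment> \<open>The target ring is left open: integers with \<open>g = 1\<close> compare
    degrees, complex numbers with \<open>g q = 1 / (z - q)\<close> give the logarithmic
    derivative.\<close>
  have split_sum: "(\<Sum>q\<in>S. of_int (a q) * g q) =
      (\<Sum>q\<in>T. of_nat (k q) * g q) - (\<Sum>q\<in>U. of_nat (k q) * g q)"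
    for g :: "rat \<Rightarrow> 'b::comm_ring_1"
  proof -
    have "(\<Sum>q\<in>T. of_int (a q) * g q) = (\<Sum>q\<in>T. of_nat (k q) * g q)"
      by (rule sum.cong) (simp_all add: T_def k_def)
    moreover have "(\<Sum>q\<in>U. of_int (a q) * g q) = - (\<Sum>q\<in>U. of_nat (k q) * g q)"
      unfolding sum_negf[symmetric] by (rule sum.cong) (simp_all add: U_def k_def)
    ultimately show ?thesis
      using TU by (simp add: sum.union_disjoint)
  qed
  have "rat_of_int (\<Sum>q\<in>S. a q) = of_int N * (\<Sum>q\<in>S. w q)"
    by (simp add: a sum_distrib_left)
  also have "(\<Sum>q\<in>S. w q) = 0"
    using sum_lagrange_weights_eq_0[of S "\<lambda>q. q"] assms True by (simp add: w_def)
  finally have "(\<Sum>q\<in>S. a q) = 0"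
    unfolding mult_zero_right of_int_eq_0_iff .
  then have "int (sum k T) = int (sum k U)"
    using split_sum[of "\<lambda>_. 1 :: int"] by simp
  then have deg: "sum k T = sum k U"
    unfolding of_nat_eq_iff .
  define A where "A = (linear_prod of_rat k T :: complex poly)"
  define B where "B = (linear_prod of_rat k U :: complex poly)"
  \<comment> \<open>The Wronskian is \<open>A * B\<close> times the difference of the logarithmic
    derivatives of \<open>A\<close> and \<open>B\<close>, and that difference is \<open>N\<close>
    over the product of all \<open>z - q\<close>.\<close>
  have wronskian: "poly (pderiv A * B - A * pderiv B) z \<noteq> 0" if z: "z \<notin> of_rat ` S" for z
  proof -
    have nz: "z \<noteq> of_rat q" if "q \<in> S" for q
      using z that by blast
    have a_complex: "of_int (a q) = of_int N * (1 / (\<Prod>j\<in>S - {q}. complex_of_rat q - of_rat j))"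
      if "q \<in> S" for q
    proof -
      have "complex_of_rat (of_int (a q)) = of_rat (of_int N * w q)"
        using a[OF that] by simp
      then show ?thesis
        by (simp add: w_def of_rat_mult of_rat_divide of_rat_prod of_rat_diff)
    qed
    have "(\<Sum>q\<in>T. of_nat (k q) / (z - of_rat q)) - (\<Sum>q\<in>U. of_nat (k q) / (z - of_rat q)) =
        (\<Sum>q\<in>S. of_int (a q) / (z - of_rat q))"
      using split_sum[of "\<lambda>q. 1 / (z - of_rat q)"] by simp
    also have "\<dots> = of_int N *
        (\<Sum>q\<in>S. 1 / (\<Prod>j\<in>S - {q}. complex_of_rat q - of_rat j) / (z - of_rat q))"
      by (simp add: a_complex sum_distrib_left)
    also have "\<dots> = of_int N * (1 / (\<Prod>q\<in>S. z - of_rat q))"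
      using assms nz by (subst sum_lagrange_weights_div) (auto simp: inj_on_def)
    also have "\<dots> \<noteq> 0"
      using N assms nz by auto
    finally have log_deriv: "(\<Sum>q\<in>T. of_nat (k q) / (z - of_rat q)) -
        (\<Sum>q\<in>U. of_nat (k q) / (z - of_rat q)) \<noteq> 0" .
    have "poly (pderiv A * B - A * pderiv B) z = poly A z * poly B z *
        ((\<Sum>q\<in>T. of_nat (k q) / (z - of_rat q)) - (\<Sum>q\<in>U. of_nat (k q) / (z - of_rat q)))"
      using TU nz by (simp add: A_def B_def poly_pderiv_linear_prod algebra_simps)
    moreover have "poly A z \<noteq> 0" "poly B z \<noteq> 0"
      using TU nz by (auto simp: A_def B_def poly_linear_prod)
    ultimately show ?thesis
      using log_deriv by simp
  qed
  show ?thesis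
    using TU deg a_nonzero wronskian unfolding A_def B_def
    by (intro linear_prod_ratfun[of T U k]) (auto simp: k_def)
qed

theorem theorem3:
  fixes n :: nat and q :: "nat \<Rightarrow> rat"
  assumes "n \<ge> 2"
  shows "\<exists>f :: rat poly fract.
    (\<forall>i\<in>{1..n}. P1_map (complexify f) (Fin (of_rat (q i))) \<in> {Fin 0, Infty}) \<and>
    P1_map (complexify f) Infty = Fin 1 \<and>
    (\<forall>P :: complex P1. P \<notin> insert Infty ((\<lambda>i. Fin (of_rat (q i))) ` {1..n}) \<longrightarrow>
       unramified_at (complexify f) P)"
  \<comment> \<open>Passing to the set of values of \<open>q\<close> absorbs repetitions among the
    given numbers.\<close>
  using ratfun_unramified_outside_exists[of "q ` {1..n}"] assms by (simp add: image_image)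

end
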